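(* Fix $N\ge1$ and consider prefixes for $I_N=\mathrm{Av}_N(321)$, with strike probabilities regarded as pairs (numerator, denominator). (1) If $p$ is an eligible prefix containing at least one inversion, then $S_N(p)=S_{N-1}(\check p)$, where $\check p$ is obtained from $p$ by removing the value $1$ and flattening, and $S_{N-1}$ is computed with respect to $\mathrm{Av}_{N-1}(321)$. (2) If $p=12\cdots k$ with $1\le k\le N$, then $S_N(p)$ has numerator $\binom{N-1}{k-1}$ and denominator $\frac{k+1}{N+1}\binom{2N-k}{N}$.
   Context: $\mathrm{Av}_N(321)$ is the set of permutations $\pi=\pi_1\cdots\pi_N$ of $[N]$ with no indices $a<b<c$ such that $\pi_a>\pi_b>\pi_c$. The $i$th prefix flattening $\pi|_{[i]}$ is the permutation of $[i]$ in the same relative order as $\pi_1,\dots,\pi_i$. A prefix (of rank $N$) is a permutation $p$ of $[k]$, $1\le k\le N$, with $p=\pi|_{[k]}$ for some $\pi\in\mathrm{Av}_N(321)$. A prefix $p=p_1\cdots p_k$ is eligible if $p_k=k$; it contains an inversion if $p_a>p_b$ for some $a<b$. The strike probability of a prefix $p$ of size $k$ is the pair $S_N(p)=\big(\#\{\pi\in\mathrm{Av}_N(321):\pi|_{[k]}=p,\ \pi_k=N\},\ \#\{\pi\in\mathrm{Av}_N(321):\pi|_{[k]}=p\}\big)$. *)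

theory Defs
  imports Complex_Main "HOL-Combinatorics.Multiset_Permutations"
begin

text \<open>
  A permutation of \<open>[N]\<close> is given by its one-line notation, a list in
  \<open>permutations_of_set {1..N}\<close>. Values start at 1, but list positions start at 0:
  the entry \<open>\<pi>\<^sub>k\<close> is \<open>\<pi> ! (k - 1)\<close>.
\<close>

definition avoids_321 :: "nat list \<Rightarrow> bool" where
  "avoids_321 \<pi> \<longleftrightarrow>
     \<not> (\<exists>a b c. a < b \<and> b < c \<and> c < length \<pi> \<and> \<pi> ! a > \<pi> ! b \<and> \<pi> ! b > \<pi> ! c)"

definition Av321 :: "nat \<Rightarrow> nat list set" where
  "Av321 N = {\<pi> \<in> permutations_of_set {1..N}. avoids_321 \<pi>}"

text \<open>For a list with distinct entries, \<open>flatten\<close> replaces each entry by its rank.\<close>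

definition flatten :: "nat list \<Rightarrow> nat list" where
  "flatten xs = map (\<lambda>x. card {y \<in> set xs. y \<le> x}) xs"

definition prefix_flattening :: "nat \<Rightarrow> nat list \<Rightarrow> nat list" where
  "prefix_flattening i \<pi> = flatten (take i \<pi>)"

definition is_prefix :: "nat \<Rightarrow> nat list \<Rightarrow> bool" where
  "is_prefix N p \<longleftrightarrow>
     (\<exists>k. 1 \<le> k \<and> k \<le> N \<and> p \<in> permutations_of_set {1..k} \<and>
          (\<exists>\<pi> \<in> Av321 N. p = prefix_flattening k \<pi>))"

definition eligible :: "nat list \<Rightarrow> bool" where
  "eligible p \<longleftrightarrow> p ! (length p - 1) = length p"

definition has_inversion :: "nat list \<Rightarrow> bool" where
  "has_inversion p \<longleftrightarrow> (\<exists>a b. a < b \<and> b < length p \<and> p ! a > p ! b)"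

text \<open>
  The strike probability, kept as the unreduced pair (numerator, denominator).
  It is meant for nonempty \<open>p\<close>.
\<close>

definition strike :: "nat \<Rightarrow> nat list \<Rightarrow> nat \<times> nat" where
  "strike N p =
     (card {\<pi> \<in> Av321 N. prefix_flattening (length p) \<pi> = p \<and> \<pi> ! (length p - 1) = N},
      card {\<pi> \<in> Av321 N. prefix_flattening (length p) \<pi> = p})"

definition remove_one :: "nat list \<Rightarrow> nat list" where
  "remove_one p = flatten (removeAll 1 p)"

end

theory Submission
  imports Defs
begin

text \<open>
  Deleting the value 1 from a 321-avoiding permutation and lowering the other values leaves a
  321-avoiding permutation, and the deletion is inverted by inserting 1 at any position before which
  the entries increase. If a prefix has an inversion, the 1 must lie inside the prefix, at
  a position dictated by the prefix, which gives the first claim. For increasing prefixes, the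
  1 is either first or beyond the prefix; this yields Pascal's recurrence for the numerator and the
  hockey-stick recurrence of the ballot numbers for the denominator.
\<close>

section \<open>Insertion of a new minimum\<close>

text \<open>Undoes the deletion of the value 1: \<open>j\<close> counts the entries in front of the
  new 1, that is, its position counted from 0.\<close>

definition insert_min :: "nat \<Rightarrow> nat list \<Rightarrow> nat list" where
  "insert_min j xs = map Suc (take j xs) @ 1 # map Suc (drop j xs)"

lemma length_insert_min [simp]: "length (insert_min j xs) = Suc (length xs)"
  by (simp add: insert_min_def)

lemma set_insert_min [simp]: "set (insert_min j xs) = insert 1 (Suc ` set xs)"
proof -
  have "set xs = set (take j xs) \<union> set (drop j xs)"
    by (metis append_take_drop_id set_append)
  then show ?thesis by (auto simp: insert_min_def)
qed

lemma nth_insert_min: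
  assumes "j \<le> length xs" "i \<le> length xs"
  shows "insert_min j xs ! i = (if i < j then Suc (xs ! i) else if i = j then 1 else Suc (xs ! (i - 1)))"
proof -
  have "i - j = Suc (i - 1 - j)" if "j < i" using that by simp
  then show ?thesis using assms by (auto simp: insert_min_def nth_append)
qed

text \<open>A prefix of length \<open>Suc k\<close> either contains the new 1 or stops before it.
  Every later case distinction on \<open>j\<close> \<le> \<open>k\<close> rests on this
  dichotomy.\<close>

lemma take_insert_min:
  assumes "j \<le> length xs"
  shows "take (Suc k) (insert_min j xs) =
    (if j \<le> k then insert_min j (take k xs) else map Suc (take (Suc k) xs))"
proof (cases "j \<le> k")
  case True
  then show ?thesis
    using assms by (simp add: insert_min_def Suc_diff_le take_map drop_take min_def)
next
  case False
  then show ?thesis using assms by (simp add: insert_min_def take_map min_def)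
qed

text \<open>Without 0 among the old entries, all raised entries are at least 2. The inserted 1
  therefore occurs once and marks the cut, whose position is the length of the part before
  it.\<close>

lemma insert_min_inject:
  assumes "0 \<notin> set xs" "0 \<notin> set ys" "i \<le> length xs" "j \<le> length ys"
  shows "insert_min i xs = insert_min j ys \<longleftrightarrow> i = j \<and> xs = ys"
proof
  assume eq: "insert_min i xs = insert_min j ys"
  have "1 \<notin> set (map Suc (take i xs))" "1 \<notin> set (map Suc (drop i xs))"
    "1 \<notin> set (map Suc (take j ys))" "1 \<notin> set (map Suc (drop j ys))"
    using assms(1,2) by (auto dest: in_set_takeD in_set_dropD)
  then have *: "map Suc (take i xs) = map Suc (take j ys)" "map Suc (drop i xs) = map Suc (drop j ys)"
    using eq by (auto simp: insert_min_def append_Cons_eq_iff)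
  from *(1) have t: "take i xs = take j ys" by (simp add: inj_map_eq_map)
  from *(2) have d: "drop i xs = drop j ys" by (simp add: inj_map_eq_map)
  from t have "length (take i xs) = length (take j ys)" by simp
  then have "i = j" using assms by simp
  moreover have "xs = ys" using t d by (metis append_take_drop_id)
  ultimately show "i = j \<and> xs = ys" ..
qed simp

text \<open>The new 1, being the strict minimum, can only be the last entry of a 321 pattern, and it
  is one exactly when an inversion precedes it.\<close>

lemma avoids_321_insert_min:
  assumes j: "j \<le> length xs" and pos: "0 \<notin> set xs"
  shows "avoids_321 (insert_min j xs) \<longleftrightarrow> avoids_321 xs \<and> sorted (take j xs)"
proof (intro iffI conjI)
  assume L: "avoids_321 (insert_min j xs)"
  show "avoids_321 xs"
    unfolding avoids_321_def
  proof (intro notI, elim exE conjE)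
    fix a b c assume A: "a < b" "b < c" "c < length xs" "xs ! a > xs ! b" "xs ! b > xs ! c"
    \<comment> \<open>\<open>g\<close> sends positions of \<open>xs\<close> to positions of the new
      word, skipping \<open>j\<close>.\<close>
    define g where "g i = (if i < j then i else Suc i)" for i
    have g: "insert_min j xs ! g i = Suc (xs ! i)" if "i < length xs" for i
      using that j by (simp add: nth_insert_min g_def)
    have "g a < g b" "g b < g c" "g c < length (insert_min j xs)"
      using A by (auto simp: g_def)
    moreover have "insert_min j xs ! g a > insert_min j xs ! g b"
      "insert_min j xs ! g b > insert_min j xs ! g c" using A by (simp_all add: g)
    ultimately show False using L unfolding avoids_321_def by blast
  qed
  show "sorted (take j xs)"
  proof (rule ccontr)
    assume "\<not> sorted (take j xs)"
    then obtain a b where ab: "a < b" "b < j" "xs ! a > xs ! b"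
      using j by (auto simp: sorted_iff_nth_mono_less not_le)
    have "xs ! b \<noteq> 0" using pos ab j by (metis nth_mem order_less_le_trans)
    then have "insert_min j xs ! a > insert_min j xs ! b" "insert_min j xs ! b > insert_min j xs ! j"
      using ab j by (simp_all add: nth_insert_min)
    moreover have "j < length (insert_min j xs)" using j by simp
    ultimately show False using L ab unfolding avoids_321_def by blast
  qed
next
  assume R: "avoids_321 xs \<and> sorted (take j xs)"
  show "avoids_321 (insert_min j xs)"
    unfolding avoids_321_def
  proof (intro notI, elim exE conjE)
    fix a b c
    let ?p = "insert_min j xs"
    assume A: "a < b" "b < c" "c < length ?p" "?p ! a > ?p ! b" "?p ! b > ?p ! c"
    have ge1: "?p ! i \<ge> 1" if "i \<le> length xs" for i
      using that j by (simp add: nth_insert_min)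
    have [simp]: "?p ! j = 1" using j by (simp add: nth_insert_min)
    have "b \<noteq> j" "a \<noteq> j" using A ge1[of b] ge1[of c] by auto
    \<comment> \<open>Off \<open>j\<close>, \<open>h\<close> sends positions of the new word back to
      positions of \<open>xs\<close>; only \<open>c\<close> can still be the position of the
      1.\<close>
    define h where "h i = (if i < j then i else i - 1)" for i
    have h: "?p ! i = Suc (xs ! h i)" if "i \<le> length xs" "i \<noteq> j" for i
      using that j by (simp add: nth_insert_min h_def)
    have hab: "xs ! h a > xs ! h b" "h a < h b" using A h[of a] h[of b] \<open>b \<noteq> j\<close> \<open>a \<noteq> j\<close>
      by (auto simp: h_def split: if_splits)
    show False
    proof (cases "c = j")
      case True
      then have "h a = a" "h b = b" using A by (auto simp: h_def)
      then have "xs ! a \<le> xs ! b"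
        using R A True j by (auto simp: sorted_iff_nth_mono_less)
      then show False using hab \<open>h a = a\<close> \<open>h b = b\<close> by simp
    next
      case False
      then have "xs ! h b > xs ! h c" "h b < h c" "h c < length xs"
        using A h[of b] h[of c] \<open>b \<noteq> j\<close> j by (auto simp: h_def split: if_splits)
      then show False using R hab unfolding avoids_321_def by blast
    qed
  qed
qed

section \<open>Decomposition of 321-avoiding permutations by the position of 1\<close>

lemma insert_min_permutations:
  assumes "xs \<in> permutations_of_set {1..n}"
  shows "insert_min j xs \<in> permutations_of_set {1..Suc n}"
proof -
  have s: "set xs = {1..n}" and d: "distinct xs"
    using assms by (auto simp: permutations_of_set_def)
  have "set (insert_min j xs) = {1..Suc n}"
    by (simp only: set_insert_min s image_Suc_atLeastAtMost) auto
  moreover have "distinct (take j xs @ drop j xs)" using d by simp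
  then have "distinct (insert_min j xs)"
    using s by (auto simp: insert_min_def distinct_map simp del: append_take_drop_id
        dest: in_set_takeD in_set_dropD)
  ultimately show ?thesis by (auto simp: permutations_of_set_def)
qed

lemma permutations_insert_min:
  assumes "p \<in> permutations_of_set {1..Suc n}"
  obtains j xs where "j \<le> n" "xs \<in> permutations_of_set {1..n}" "p = insert_min j xs"
proof -
  have s: "set p = {1..Suc n}" and d: "distinct p"
    using assms by (auto simp: permutations_of_set_def)
  then have "1 \<in> set p" by simp
  then obtain as bs where p: "p = as @ 1 # bs" by (meson split_list)
  have ge1: "x \<ge> 1" if "x \<in> set (as @ bs)" for x
    using that s p by (metis Un_iff atLeastAtMost_iff list.set_intros(2) set_append)
  \<comment> \<open>By \<open>ge1\<close> the truncated subtraction is exact, so \<open>Suc\<close>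
    recovers the entries around the 1.\<close>
  define xs where "xs = map (\<lambda>x. x - 1) (as @ bs)"
  have m: "map Suc xs = as @ bs"
    unfolding xs_def map_map
  proof (rule map_idI)
    fix x assume "x \<in> set (as @ bs)"
    then show "(Suc \<circ> (\<lambda>x. x - 1)) x = x" using ge1[of x] by simp
  qed
  have "set (as @ bs) = {1..Suc n} - {1}" using s d p by auto
  also have "\<dots> = Suc ` {1..n}" by (auto simp: image_Suc_atLeastAtMost)
  finally have "Suc ` set xs = Suc ` {1..n}" using m by (metis set_map)
  then have set_xs: "set xs = {1..n}" by (rule inj_image_eq_iff[THEN iffD1, rotated]) simp
  have "distinct (map Suc xs)" using d p unfolding m by simp
  then have "distinct xs" by (simp add: distinct_map)
  with set_xs have xs: "xs \<in> permutations_of_set {1..n}" by (auto simp: permutations_of_set_def)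
  have "length xs = n" using xs by (simp add: length_finite_permutations_of_set)
  then have "length as \<le> n" by (simp add: xs_def)
  moreover have "p = insert_min (length as) xs"
    unfolding insert_min_def take_map[symmetric] drop_map[symmetric] m p by simp
  ultimately show thesis using that xs by blast
qed

lemma Av321D:
  assumes "xs \<in> Av321 n"
  shows "set xs = {1..n}" "distinct xs" "length xs = n" "avoids_321 xs"
proof -
  have "xs \<in> permutations_of_set {1..n}" "avoids_321 xs"
    using assms by (simp_all add: Av321_def)
  then show "set xs = {1..n}" "distinct xs" "length xs = n" "avoids_321 xs"
    using permutations_of_setD length_finite_permutations_of_set by fastforce+
qed

lemma finite_Av321 [simp]: "finite (Av321 n)"
  by (simp add: Av321_def)

text \<open>Insertion is a bijection from pairs of a permutation of size \<open>n\<close> and an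
  admissible position. The predicate \<open>P\<close> is left arbitrary so that the same sum serves
  for numerators and denominators.\<close>

lemma card_Av321_Suc:
  "card {p \<in> Av321 (Suc n). P p} =
    (\<Sum>j\<le>n. card {xs \<in> Av321 n. sorted (take j xs) \<and> P (insert_min j xs)})"
proof -
  let ?S = "\<lambda>j. {xs \<in> Av321 n. sorted (take j xs) \<and> P (insert_min j xs)}"
  have inj: "inj_on (\<lambda>(j, xs). insert_min j xs) (Sigma {..n} ?S)"
  proof (rule inj_onI)
    fix u v
    assume *: "u \<in> Sigma {..n} ?S" "v \<in> Sigma {..n} ?S"
      "(\<lambda>(j, xs). insert_min j xs) u = (\<lambda>(j, xs). insert_min j xs) v"
    obtain i xs j ys where uv: "u = (i, xs)" "v = (j, ys)" by (cases u, cases v)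
    then have "i = j \<and> xs = ys"
      using * insert_min_inject[of xs ys i j] Av321D[of xs n] Av321D[of ys n] by simp
    then show "u = v" using uv by simp
  qed
  have image: "(\<lambda>(j, xs). insert_min j xs) ` Sigma {..n} ?S = {p \<in> Av321 (Suc n). P p}"
  proof (intro equalityI subsetI)
    fix p assume "p \<in> (\<lambda>(j, xs). insert_min j xs) ` Sigma {..n} ?S"
    then obtain j xs where *: "j \<le> n" "xs \<in> Av321 n" "sorted (take j xs)" "P p" "p = insert_min j xs"
      by auto
    then show "p \<in> {p \<in> Av321 (Suc n). P p}"
      using insert_min_permutations[of xs n j] avoids_321_insert_min[of j xs] Av321D[of xs n]
      by (auto simp: Av321_def)
  next
    fix p assume p: "p \<in> {p \<in> Av321 (Suc n). P p}"
    then obtain j xs where *: "j \<le> n" "xs \<in> permutations_of_set {1..n}" "p = insert_min j xs"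
      using permutations_insert_min[of p n] unfolding Av321_def by blast
    have "set xs = {1..n}" "length xs = n"
      using * by (auto simp: permutations_of_set_def length_finite_permutations_of_set)
    then have "(j, xs) \<in> Sigma {..n} ?S"
      using p * avoids_321_insert_min[of j xs] by (auto simp: Av321_def)
    then show "p \<in> (\<lambda>(j, xs). insert_min j xs) ` Sigma {..n} ?S"
      using *(3) by (auto simp: image_iff)
  qed
  have "card {p \<in> Av321 (Suc n). P p} = card (Sigma {..n} ?S)"
    using card_image[OF inj] unfolding image .
  then show ?thesis by simp
qed

section \<open>Flattening and relative order\<close>

lemma length_flatten [simp]: "length (flatten xs) = length xs"
  by (simp add: flatten_def)

text \<open>Ranks grow weakly with the entries, and strictly because the larger of two entries is
  counted in its own rank but not in that of the smaller.\<close>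

lemma flatten_nth_less_iff:
  assumes "i < length xs" "j < length xs"
  shows "flatten xs ! i < flatten xs ! j \<longleftrightarrow> xs ! i < xs ! j"
proof -
  let ?r = "\<lambda>x. card {y \<in> set xs. y \<le> x}"
  have less: "?r x < ?r y" if "x < y" "y \<in> set xs" for x y
    proof -
    have "y \<in> {z \<in> set xs. z \<le> y} - {z \<in> set xs. z \<le> x}" using that by auto
    then have "{z \<in> set xs. z \<le> x} \<subset> {z \<in> set xs. z \<le> y}"
      using that(1) by (intro psubsetI) (force, blast)
    then show ?thesis by (intro psubset_card_mono) auto
  qed
  have mono: "?r x \<le> ?r y" if "x \<le> y" for x y
    using that by (intro card_mono) auto
  show ?thesis
    using assms less[of "xs ! i" "xs ! j"] mono[of "xs ! j" "xs ! i"]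
    by (auto simp: flatten_def not_less[symmetric])
qed

lemma flatten_permutation:
  assumes "xs \<in> permutations_of_set {1..n}"
  shows "flatten xs = xs"
proof -
  have s: "set xs = {1..n}" using assms by (auto simp: permutations_of_set_def)
  have "card {y \<in> set xs. y \<le> x} = x" if "x \<in> set xs" for x
  proof -
    have "{y \<in> set xs. y \<le> x} = {1..x}" using that s by auto
    then show ?thesis by simp
  qed
  then show ?thesis unfolding flatten_def by (intro map_idI)
qed

lemma flatten_map_Suc: "flatten (map Suc xs) = flatten xs"
proof -
  have "{y \<in> Suc ` set xs. y \<le> Suc x} = Suc ` {y \<in> set xs. y \<le> x}" for x by auto
  then show ?thesis by (simp add: flatten_def card_image)
qed

text \<open>Every old entry gains exactly one smaller entry, so its rank rises by one, just as its
  value does under insertion.\<close>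

lemma flatten_insert_min:
  assumes "0 \<notin> set xs"
  shows "flatten (insert_min j xs) = insert_min j (flatten xs)"
proof -
  have rank_Suc: "card {y \<in> insert 1 (Suc ` set xs). y \<le> Suc x} = Suc (card {y \<in> set xs. y \<le> x})" for x
  proof -
    have "{y \<in> insert 1 (Suc ` set xs). y \<le> Suc x} = insert 1 (Suc ` {y \<in> set xs. y \<le> x})" by auto
    moreover have "1 \<notin> Suc ` {y \<in> set xs. y \<le> x}" using assms by auto
    ultimately show ?thesis by (simp add: card_image)
  qed
  have "{y \<in> insert 1 (Suc ` set xs). y \<le> 1} = {1}" by auto
  then have rank_1: "card {y \<in> insert 1 (Suc ` set xs). y \<le> 1} = 1" by simp
  show ?thesis
    unfolding flatten_def set_insert_min unfolding insert_min_def
    by (simp only: list.map map_append map_map take_map drop_map o_def rank_Suc rank_1)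
qed

lemma sorted_flatten_iff: "sorted (flatten xs) \<longleftrightarrow> sorted xs"
  by (auto simp: sorted_iff_nth_mono_less not_less[symmetric] flatten_nth_less_iff)

lemma avoids_321_flatten_iff: "avoids_321 (flatten xs) \<longleftrightarrow> avoids_321 xs"
proof -
  have "(flatten xs ! a > flatten xs ! b \<and> flatten xs ! b > flatten xs ! c) =
      (xs ! a > xs ! b \<and> xs ! b > xs ! c)" if "a < b" "b < c" "c < length xs" for a b c
    using that by (simp add: flatten_nth_less_iff)
  then show ?thesis unfolding avoids_321_def length_flatten by blast
qed

lemma avoids_321_take: "avoids_321 xs \<Longrightarrow> avoids_321 (take k xs)"
  unfolding avoids_321_def by auto

text \<open>The ranks are distinct and lie in an interval with as many elements as there are
  entries, so they fill it.\<close>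

lemma flatten_permutations:
  assumes "distinct xs"
  shows "flatten xs \<in> permutations_of_set {1..length xs}"
proof -
  have "distinct (flatten xs)"
    unfolding distinct_conv_nth
    using assms flatten_nth_less_iff[of _ xs]
    by (metis distinct_conv_nth length_flatten less_irrefl linorder_neqE_nat)
  moreover have sub: "set (flatten xs) \<subseteq> {1..length xs}"
  proof
    fix r assume "r \<in> set (flatten xs)"
    then obtain x where x: "x \<in> set xs" "r = card {y \<in> set xs. y \<le> x}"
      by (auto simp: flatten_def)
    have "r \<le> card (set xs)" unfolding x by (intro card_mono) auto
    moreover have "r > 0" using x by (auto simp: card_gt_0_iff)
    ultimately show "r \<in> {1..length xs}" using card_length[of xs] by simp
  qed
  moreover have "card (set (flatten xs)) = length xs"
    using calculation(1) by (simp add: distinct_card)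
  ultimately show ?thesis
    using card_subset_eq[OF _ sub] by (auto simp: permutations_of_set_def)
qed

text \<open>The identity is the only increasing permutation of its size, which turns the prefix
  condition for 12...k into plain sortedness.\<close>

lemma prefix_flattening_upt_iff:
  assumes "p \<in> Av321 n" "k \<le> n"
  shows "prefix_flattening k p = [1..<Suc k] \<longleftrightarrow> sorted (take k p)"
proof
  assume "prefix_flattening k p = [1..<Suc k]"
  then have "sorted (flatten (take k p))" by (simp add: prefix_flattening_def del: upt_Suc)
  then show "sorted (take k p)" by (simp add: sorted_flatten_iff)
next
  assume "sorted (take k p)"
  then have "sorted (flatten (take k p))" by (simp add: sorted_flatten_iff)
  moreover have "flatten (take k p) \<in> permutations_of_set {1..k}"
    using flatten_permutations[of "take k p"] Av321D[OF assms(1)] assms(2)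
    by (simp add: min_absorb2)
  then have "distinct (flatten (take k p))" "set (flatten (take k p)) = {1..k}"
    by (simp_all add: permutations_of_set_def)
  moreover have "set [1..<Suc k] = {1..k}" by (simp only: set_upt atLeastLessThanSuc_atLeastAtMost)
  ultimately show "prefix_flattening k p = [1..<Suc k]"
    unfolding prefix_flattening_def
    by (metis sorted_distinct_set_unique distinct_upt sorted_upt)
qed

section \<open>Counting permutations with an increasing prefix\<close>

text \<open>A 1 inside the prefix but not in front follows a larger entry. In front it is harmless,
  and beyond the prefix it is not seen.\<close>

lemma sorted_take_insert_min:
  assumes "j \<le> length xs" "0 \<notin> set xs"
  shows "sorted (take (Suc k) (insert_min j xs)) \<longleftrightarrow>
    (if j \<le> k then j = 0 \<and> sorted (take k xs) else sorted (take (Suc k) xs))"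
proof (cases "j \<le> k")
  case True
  have "sorted (insert_min j (take k xs)) \<longleftrightarrow> j = 0 \<and> sorted (take k xs)"
  proof (cases j)
    case 0
    then show ?thesis by (auto simp: insert_min_def sorted_map)
  next
    case (Suc i)
    then obtain x ys where xs: "xs = x # ys" "x \<noteq> 0" using assms by (cases xs) auto
    then have "take j (take k xs) = x # take i (take (k - 1) ys)"
      using Suc True by (cases k) auto
    then have "insert_min j (take k xs) =
        Suc x # map Suc (take i (take (k - 1) ys)) @ 1 # map Suc (drop j (take k xs))"
      by (simp add: insert_min_def)
    then show ?thesis using Suc xs by auto
  qed
  then show ?thesis using True assms by (simp add: take_insert_min)
next
  case False
  then show ?thesis using assms by (simp add: take_insert_min sorted_map del: take_Suc_Cons)
qed

lemma sorted_take_le: "sorted (take j xs) \<Longrightarrow> i \<le> j \<Longrightarrow> sorted (take i xs)"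
  by (metis min.absorb1 sorted_wrt_take take_take)

text \<open>Positions 1 to \<open>k\<close> of the 1 contribute nothing. Beyond \<open>k\<close>,
  sortedness up to \<open>j\<close> already covers the prefix. Position 0 contributes the summand
  with index \<open>k\<close>.\<close>

lemma card_sorted_take_Suc:
  assumes "k \<le> n"
  shows "card {p \<in> Av321 (Suc n). sorted (take (Suc k) p)} =
    (\<Sum>j=k..n. card {xs \<in> Av321 n. sorted (take j xs)})"
proof -
  let ?D = "\<lambda>j. {xs \<in> Av321 n. sorted (take j xs)}"
  let ?T = "\<lambda>j. {xs \<in> Av321 n. sorted (take j xs) \<and> sorted (take (Suc k) (insert_min j xs))}"
  have iff: "sorted (take (Suc k) (insert_min j xs)) \<longleftrightarrow>
      (if j \<le> k then j = 0 \<and> sorted (take k xs) else sorted (take (Suc k) xs))"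
    if "xs \<in> Av321 n" "j \<le> n" for j xs
    using that Av321D[of xs n] by (intro sorted_take_insert_min) auto
  have T0: "?T 0 = ?D k" using iff[of _ 0] by auto
  have T1: "?T j = {}" if "j \<in> {1..k}" for j using iff[of _ j] that assms by auto
  have T2: "?T j = ?D j" if "j \<in> {Suc k..n}" for j
    using iff[of _ j] that sorted_take_le[of j _ "Suc k"] by auto
  have "{..n} = insert 0 ({1..k} \<union> {Suc k..n})" using assms by auto
  then have "(\<Sum>j\<le>n. card (?T j)) = card (?T 0) + (\<Sum>j\<in>{1..k} \<union> {Suc k..n}. card (?T j))"
    by simp
  also have "\<dots> = card (?T 0) + ((\<Sum>j=1..k. card (?T j)) + (\<Sum>j=Suc k..n. card (?T j)))"
    by (subst sum.union_disjoint) auto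
  also have "(\<Sum>j=1..k. card (?T j)) = 0" using T1 by (intro sum.neutral ballI) (simp only: card.empty)
  also have "(\<Sum>j=Suc k..n. card (?T j)) = (\<Sum>j=Suc k..n. card (?D j))"
    using T2 by (intro sum.cong refl) (simp only:)
  also have "?T 0 = ?D k" by (rule T0)
  finally show ?thesis
    unfolding card_Av321_Suc using assms by (simp add: sum.atLeast_Suc_atMost)
qed

text \<open>A hockey-stick identity for each of the two binomials, by downward induction from
  \<open>n\<close>: each new summand is absorbed by Pascal's rule. Integers keep the subtraction
  from being truncated.\<close>

lemma sum_ballot:
  assumes "k \<le> n"
  shows "(\<Sum>j=k..n. int ((2 * n - j) choose n) - int ((2 * n - j) choose Suc n)) =
    int (Suc (2 * n - k) choose Suc n) - int (Suc (2 * n - k) choose Suc (Suc n))"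
  using assms
proof (induction k rule: inc_induct)
  case base
  then show ?case by simp
next
  case (step k)
  have "Suc (2 * n - Suc k) = 2 * n - k" using step by simp
  then show ?case using step by (simp add: sum.atLeast_Suc_atMost)
qed

text \<open>These are ballot numbers, written as a difference of binomials because this form fits
  the recurrence \<open>card_sorted_take_Suc\<close> summand by summand.\<close>

lemma card_sorted_take:
  assumes "k \<le> n"
  shows "int (card {p \<in> Av321 n. sorted (take k p)}) =
    int ((2 * n - k) choose n) - int ((2 * n - k) choose Suc n)"
  using assms
proof (induction n arbitrary: k)
  case 0
  have "{p \<in> Av321 0. sorted (take k p)} = {[]}"
    by (auto simp: Av321_def avoids_321_def)
  then show ?case by (simp add: 0)
next
  case (Suc n)
  have S: "int (card {p \<in> Av321 (Suc n). sorted (take (Suc k) p)}) =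
      int (Suc (2 * n - k) choose Suc n) - int (Suc (2 * n - k) choose Suc (Suc n))"
    if "k \<le> n" for k
    unfolding card_sorted_take_Suc[OF that] of_nat_sum sum_ballot[OF that, symmetric]
    by (intro sum.cong refl Suc.IH) auto
  show ?case
  proof (cases k)
    case 0
    \<comment> \<open>The recurrence only reaches prefix lengths from 1 on. Lengths 0 and 1 impose
      no condition, and the two formulas agree by the symmetry of the middle binomials.\<close>
    have eq: "{p \<in> Av321 (Suc n). sorted (take (Suc 0) p)} = {p \<in> Av321 (Suc n). sorted (take 0 p)}"
      by (auto simp: sorted_iff_nth_mono_less)
    have "Suc (2 * n) choose n = Suc (2 * n) choose Suc n"
      using binomial_symmetric[of n "Suc (2 * n)"] by (simp add: Suc_diff_le)
    then show ?thesis using S[of 0] 0 unfolding eq by simp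
  next
    case (Suc i)
    then have "i \<le> n" using Suc.prems by simp
    moreover from this have "2 * Suc n - k = Suc (2 * n - i)" using Suc by simp
    ultimately show ?thesis using S[of i] Suc by simp
  qed
qed

section \<open>Counting increasing prefixes that end in the maximum\<close>

text \<open>Only two positions of the 1 survive: in front, which moves the maximum to
  \<open>k - 1\<close> in the smaller permutation, and directly after the prefix, which leaves it at
  \<open>k\<close>. Their counts add up by Pascal's rule.\<close>

lemma card_sorted_take_max:
  assumes "k < n"
  shows "card {p \<in> Av321 n. sorted (take (Suc k) p) \<and> p ! k = n} = (n - 1) choose k"
  using assms
proof (induction n arbitrary: k)
  case 0
  then show ?case by simp
next
  case (Suc n)
  let ?E = "\<lambda>k. {xs \<in> Av321 n. sorted (take (Suc k) xs) \<and> xs ! k = n}"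
  let ?T = "\<lambda>j. {xs \<in> Av321 n. sorted (take j xs) \<and>
      (sorted (take (Suc k) (insert_min j xs)) \<and> insert_min j xs ! k = Suc n)}"
  \<comment> \<open>For \<open>j = 0\<close> and \<open>k = 0\<close> the inspected entry is the 1
    itself, which is the maximum only if \<open>n = 0\<close>.\<close>
  have iff: "sorted (take (Suc k) (insert_min j xs)) \<and> insert_min j xs ! k = Suc n \<longleftrightarrow>
      (if j \<le> k then j = 0 \<and> sorted (take k xs) \<and> (if k = 0 then n = 0 else xs ! (k - 1) = n)
       else sorted (take (Suc k) xs) \<and> xs ! k = n)"
    if "xs \<in> Av321 n" "j \<le> n" for j xs
    using that Av321D[of xs n] Suc.prems sorted_take_insert_min[of j xs k] nth_insert_min[of j xs k]
    by auto
  have zero: "?T j = {}" if "j \<le> n" "j \<noteq> 0" "j \<noteq> Suc k" for j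
  proof (cases "j \<le> k")
    case True
    then show ?thesis using iff[of _ j] that by auto
  next
    case False
    show ?thesis
    proof (rule equals0I)
      fix xs assume "xs \<in> ?T j"
      then have xs: "xs \<in> Av321 n" "sorted (take j xs)" "xs ! k = n"
        using iff[of xs j] that False by auto
      \<comment> \<open>The increasing part before the 1 would extend past the maximum
        \<open>n\<close> at position \<open>k\<close>.\<close>
      have "Suc k < j" using False that by simp
      then have "Suc k < length xs" using that Av321D[OF xs(1)] by simp
      then have "xs ! Suc k \<in> set xs" by (rule nth_mem)
      moreover have "xs ! k \<noteq> xs ! Suc k"
        using Av321D[OF xs(1)] \<open>Suc k < length xs\<close> by (simp add: nth_eq_iff_index_eq)
      moreover have "xs ! k \<le> xs ! Suc k"
        using xs(2) \<open>Suc k < j\<close> that Av321D[OF xs(1)] by (auto simp: sorted_iff_nth_mono_less)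
      ultimately show False using xs(3) Av321D[OF xs(1)] by auto
    qed
  qed
  have T0: "card (?T 0) = (if k = 0 then (if n = 0 then 1 else 0) else (n - 1) choose (k - 1))"
  proof (cases k)
    case 0
    have "?T 0 = (if n = 0 then Av321 0 else {})" using iff[of _ 0] 0 by auto
    moreover have "Av321 0 = {[]}" by (auto simp: Av321_def avoids_321_def)
    ultimately show ?thesis using 0 by simp
  next
    case (Suc i)
    have "?T 0 = ?E i" using iff[of _ 0] Suc by auto
    then show ?thesis using Suc.IH[of i] Suc \<open>k < Suc n\<close> by simp
  qed
  have T1: "card (?T (Suc k)) = (n - 1) choose k" if "k < n"
  proof -
    have "?T (Suc k) = ?E k" using iff[of _ "Suc k"] that by auto
    then show ?thesis using Suc.IH[OF that] by simp
  qed
  have "card {p \<in> Av321 (Suc n). sorted (take (Suc k) p) \<and> p ! k = Suc n} = (\<Sum>j\<le>n. card (?T j))"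
    by (rule card_Av321_Suc)
  \<comment> \<open>If \<open>k = n\<close>, no position \<open>Suc k\<close> is available, and the
    summand for position 0 alone gives the binomial.\<close>
  also have "\<dots> = (\<Sum>j\<in>(if k < n then {0, Suc k} else {0}). card (?T j))"
  proof (rule sum.mono_neutral_right)
    show "\<forall>j\<in>{..n} - (if k < n then {0, Suc k} else {0}). card (?T j) = 0"
    proof
      fix j assume "j \<in> {..n} - (if k < n then {0, Suc k} else {0})"
      then have "?T j = {}" by (intro zero) (auto split: if_splits)
      then show "card (?T j) = 0" by (simp only: card.empty)
    qed
  qed auto
  also have "\<dots> = card (?T 0) + (if k < n then card (?T (Suc k)) else 0)" by simp
  also have "\<dots> = n choose k"
  proof (cases n)
    case 0
    then show ?thesis using T0 Suc.prems by simp
  next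
    case n: (Suc m)
    show ?thesis
    proof (cases k)
      case 0
      then show ?thesis using n T0 T1 by simp
    next
      case (Suc i)
      then show ?thesis using n T0 T1 Suc.prems by (cases "k < n") (auto simp: not_less le_Suc_eq)
    qed
  qed
  finally show ?case by simp
qed

section \<open>Strike probabilities of increasing prefixes\<close>

lemma strike_upt:
  assumes "1 \<le> k" "k \<le> N"
  shows "fst (strike N [1..<Suc k]) = (N - 1) choose (k - 1)"
    and "real (snd (strike N [1..<Suc k])) =
      (real k + 1) / (real N + 1) * real ((2 * N - k) choose N)"
proof -
  obtain i where k: "k = Suc i" using assms by (cases k) auto
  have "{\<pi> \<in> Av321 N. prefix_flattening k \<pi> = [1..<Suc k] \<and> \<pi> ! (k - 1) = N} =
      {\<pi> \<in> Av321 N. sorted (take k \<pi>) \<and> \<pi> ! (k - 1) = N}"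
    using prefix_flattening_upt_iff[OF _ assms(2)] by blast
  then show "fst (strike N [1..<Suc k]) = (N - 1) choose (k - 1)"
    using card_sorted_take_max[of i N] assms k by (simp add: strike_def del: upt_Suc)
  have "{\<pi> \<in> Av321 N. prefix_flattening k \<pi> = [1..<Suc k]} = {\<pi> \<in> Av321 N. sorted (take k \<pi>)}"
    using prefix_flattening_upt_iff[OF _ assms(2)] by blast
  then have "int (snd (strike N [1..<Suc k])) =
      int ((2 * N - k) choose N) - int ((2 * N - k) choose Suc N)"
    using card_sorted_take[OF assms(2)] by (simp add: strike_def del: upt_Suc)
  then have "real_of_int (int (snd (strike N [1..<Suc k]))) =
      real_of_int (int ((2 * N - k) choose N) - int ((2 * N - k) choose Suc N))" by simp
  then have *: "real (snd (strike N [1..<Suc k])) =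
      real ((2 * N - k) choose N) - real ((2 * N - k) choose Suc N)" by (simp del: upt_Suc)
  \<comment> \<open>Absorption expresses the second binomial by the first. After multiplication by
    \<open>N + 1\<close> the difference has the factor (N + 1) - (N - k) = k + 1.\<close>
  have "Suc N * ((2 * N - k) choose Suc N) = (2 * N - k - N) * ((2 * N - k) choose N)"
    by (metis binomial_absorb_comp binomial_absorption mult.commute)
  also have "2 * N - k - N = N - k" by simp
  finally have "real (Suc N * ((2 * N - k) choose Suc N)) = real ((N - k) * ((2 * N - k) choose N))"
    by simp
  then have "(real N + 1) * real ((2 * N - k) choose Suc N) =
      (real N - real k) * real ((2 * N - k) choose N)"
    using assms by (simp add: of_nat_diff algebra_simps)
  then have "(real N + 1) * real (snd (strike N [1..<Suc k])) =
      (real k + 1) * real ((2 * N - k) choose N)"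
    unfolding * by (simp add: algebra_simps)
  then show "real (snd (strike N [1..<Suc k])) =
      (real k + 1) / (real N + 1) * real ((2 * N - k) choose N)"
    by (simp add: field_simps del: upt_Suc)
qed

section \<open>Strike probabilities of prefixes with an inversion\<close>

lemma strike_remove_one:
  assumes "is_prefix N p" "eligible p" "has_inversion p"
  shows "strike N p = strike (N - 1) (remove_one p)"
proof -
  obtain \<pi> where p: "p \<in> permutations_of_set {1..length p}" "length p \<le> N"
    and \<pi>: "\<pi> \<in> Av321 N" "p = prefix_flattening (length p) \<pi>"
    using assms(1) unfolding is_prefix_def
    by (metis card_atLeastAtMost diff_Suc_1 length_finite_permutations_of_set)
  have avoids: "avoids_321 p"
    using \<pi> Av321D(4)[OF \<pi>(1)]
    by (metis avoids_321_flatten_iff avoids_321_take prefix_flattening_def)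
  have not_sorted: "\<not> sorted p"
    using assms(3) unfolding has_inversion_def by (auto simp: sorted_iff_nth_mono_less not_le)
  \<comment> \<open>\<open>k\<close> is the position of the last entry of \<open>p\<close> counted
    from 0, and also the length of the reduced prefix \<open>q\<close>.\<close>
  obtain k where k: "length p = Suc k" using not_sorted by (cases "length p") auto
  obtain n where n: "N = Suc n" using k p(2) by (cases N) auto
  obtain i q where q: "i \<le> k" "q \<in> permutations_of_set {1..k}" "p = insert_min i q"
    using permutations_insert_min p(1) k by metis
  have sq: "set q = {1..k}" "length q = k"
    using q(2) by (auto simp: permutations_of_set_def length_finite_permutations_of_set)
  have "k \<le> n" using k n p(2) by simp
  have "k \<noteq> 0" using not_sorted k by (cases p) auto
  have "p ! k = Suc k" using assms(2) k by (simp add: eligible_def)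
  \<comment> \<open>The last entry of an eligible \<open>p\<close> is its maximum
    \<open>Suc k\<close>, which exceeds 1, so the 1 sits strictly earlier.\<close>
  then have "i \<noteq> k" using nth_insert_min[of i q k] q sq \<open>k \<noteq> 0\<close> by auto
  have "removeAll 1 p = map Suc q"
  proof -
    have "1 \<notin> set (map Suc (take i q))" "1 \<notin> set (map Suc (drop i q))"
      using sq by (auto dest: in_set_takeD in_set_dropD)
    then have "removeAll 1 p = map Suc (take i q) @ map Suc (drop i q)"
      unfolding q(3) insert_min_def by (simp add: removeAll_id)
    then show ?thesis by (metis append_take_drop_id map_append)
  qed
  then have rem: "remove_one p = q"
    using flatten_permutation[OF q(2)] by (simp add: remove_one_def flatten_map_Suc)
  have sorted_q: "sorted (take i q)"
    using avoids avoids_321_insert_min[of i q] q sq by simp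
  \<comment> \<open>The core of the reduction: a completion of \<open>p\<close> has its 1 at the
    position \<open>i\<close> dictated by \<open>p\<close>, and deleting it leaves a completion of
    \<open>q\<close>.\<close>
  have iff: "sorted (take j xs) \<and> prefix_flattening (Suc k) (insert_min j xs) = p \<longleftrightarrow>
      j = i \<and> prefix_flattening k xs = q" if "xs \<in> Av321 n" "j \<le> n" for j xs
  proof -
    note xs = Av321D[OF that(1)]
    have nz: "0 \<notin> set (take k xs)" using xs by (auto dest: in_set_takeD)
    have perm: "flatten (take k xs) \<in> permutations_of_set {1..k}"
      using flatten_permutations[of "take k xs"] xs \<open>k \<le> n\<close> by (simp add: min_absorb2)
    show ?thesis
    proof (cases "j \<le> k")
      case True
      then have "prefix_flattening (Suc k) (insert_min j xs) = insert_min j (flatten (take k xs))"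
        using take_insert_min[of j xs k] xs that flatten_insert_min[OF nz]
        by (simp add: prefix_flattening_def)
      moreover have "insert_min j (flatten (take k xs)) = insert_min i q \<longleftrightarrow>
          j = i \<and> flatten (take k xs) = q"
        using perm True q sq xs \<open>k \<le> n\<close>
        by (intro insert_min_inject) (auto simp: permutations_of_set_def)
      \<comment> \<open>The admissibility of position \<open>i\<close> is automatic: the first
        \<open>i\<close> entries of \<open>xs\<close> are ordered like those of \<open>q\<close>,
        which increase since \<open>p\<close> avoids 321.\<close>
      moreover have "sorted (take i xs)" if "flatten (take k xs) = q"
      proof -
        have "xs ! a \<le> xs ! b" if "a < b" "b < i" for a b
        proof -
          have "q ! a \<le> q ! b" using sorted_q that q sq by (auto simp: sorted_iff_nth_mono_less)
          then show ?thesis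
            using flatten_nth_less_iff[of b "take k xs" a] \<open>flatten (take k xs) = q\<close>
              that q xs \<open>k \<le> n\<close> by (simp add: not_less[symmetric])
        qed
        then show ?thesis using q xs \<open>k \<le> n\<close> by (auto simp: sorted_iff_nth_mono_less)
      qed
      ultimately show ?thesis by (auto simp: prefix_flattening_def q(3))
    next
      case False
      then have "prefix_flattening (Suc k) (insert_min j xs) = flatten (take (Suc k) xs)"
        using take_insert_min[of j xs k] xs that
        by (simp add: prefix_flattening_def flatten_map_Suc)
      \<comment> \<open>A 1 beyond the prefix would force the whole prefix to increase, against the
        inversion in \<open>p\<close>.\<close>
      moreover have "sorted (flatten (take (Suc k) xs))" if "sorted (take j xs)"
        using sorted_take_le[OF that, of "Suc k"] False by (simp add: sorted_flatten_iff)
      ultimately show ?thesis using not_sorted False q(1) by auto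
    qed
  qed
  \<comment> \<open>\<open>P\<close> will be the strike event for the numerator and
    \<open>True\<close> for the denominator.\<close>
  have card_eq: "card {\<pi> \<in> Av321 N. prefix_flattening (Suc k) \<pi> = p \<and> P \<pi>} =
      card {xs \<in> Av321 n. prefix_flattening k xs = q \<and> P (insert_min i xs)}" for P
  proof -
    have "{xs \<in> Av321 n. sorted (take j xs) \<and>
          (prefix_flattening (Suc k) (insert_min j xs) = p \<and> P (insert_min j xs))} =
        (if j = i then {xs \<in> Av321 n. prefix_flattening k xs = q \<and> P (insert_min i xs)} else {})"
      if "j \<le> n" for j using iff[OF _ that] by auto
    then have "card {\<pi> \<in> Av321 N. prefix_flattening (Suc k) \<pi> = p \<and> P \<pi>} =
        (\<Sum>j\<le>n. if j = i then card {xs \<in> Av321 n. prefix_flattening k xs = q \<and> P (insert_min i xs)}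
          else 0)"
      unfolding n card_Av321_Suc by (intro sum.cong refl) simp
    then show ?thesis using q(1) \<open>k \<le> n\<close> by simp
  qed
  \<comment> \<open>As \<open>i\<close> < \<open>k\<close>, the entry at \<open>k\<close> is the one
    at \<open>k - 1\<close> in \<open>xs\<close>, raised by one like the maximum.\<close>
  have "insert_min i xs ! k = N \<longleftrightarrow> xs ! (k - 1) = n" if "xs \<in> Av321 n" for xs
    using nth_insert_min[of i xs k] Av321D[OF that] q(1) \<open>k \<le> n\<close> \<open>i \<noteq> k\<close> n by auto
  then have "{xs \<in> Av321 n. prefix_flattening k xs = q \<and> insert_min i xs ! k = N} =
      {xs \<in> Av321 n. prefix_flattening k xs = q \<and> xs ! (k - 1) = n}" by blast
  then show ?thesis
    using card_eq[of "\<lambda>\<pi>. \<pi> ! k = N"] card_eq[of "\<lambda>_. True"]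
    by (simp add: strike_def rem k sq n)
qed

theorem theorem4p1:
  fixes N :: nat
  assumes "N \<ge> 1"
  shows "(\<forall>p. is_prefix N p \<and> eligible p \<and> has_inversion p \<longrightarrow>
              strike N p = strike (N - 1) (remove_one p)) \<and>
         (\<forall>k. 1 \<le> k \<and> k \<le> N \<longrightarrow>
              fst (strike N [1..<Suc k]) = (N - 1) choose (k - 1) \<and>
              real (snd (strike N [1..<Suc k])) =
                (real k + 1) / (real N + 1) * real ((2 * N - k) choose N))"
proof (intro conjI allI impI; (elim conjE)?)
  show "strike N p = strike (N - 1) (remove_one p)"
    if "is_prefix N p" "eligible p" "has_inversion p" for p
    using that by (rule strike_remove_one)
  fix k assume k: "1 \<le> k" "k \<le> N"
  show "fst (strike N [1..<Suc k]) = (N - 1) choose (k - 1)"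
    "real (snd (strike N [1..<Suc k])) = (real k + 1) / (real N + 1) * real ((2 * N - k) choose N)"
    by (rule strike_upt[OF k])+
qed

end
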